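(* There exists an algorithm running in $O(n^3)$ time that solves the problem $Q2|G=\mathrm{bipartite},\,p_j=1|C_{\max}$ exactly, i.e. given two uniform machines and $n$ unit-time jobs with a bipartite incompatibility graph, it returns a feasible schedule of minimum makespan.
   Context: Problem $Qm|G=\mathrm{bipartite},\,p_j=1|C_{\max}$: there are $m$ machines $M_1,\dots,M_m$ with speeds $s_1\ge\dots\ge s_m\ge 1$, a set of jobs $J=\{J_1,\dots,J_n\}$, each with processing requirement $p_j=1$, and a bipartite graph $G=(J,E)$ (the incompatibility graph). A (feasible) schedule assigns each job to exactly one machine such that the set of jobs assigned to any machine is an independent set in $G$. Job $J_j$ on machine $M_i$ takes time $p_j/s_i$; the completion time of $M_i$ is the sum of processing times of its jobs, and the makespan $C_{\max}$ is the maximum completion time over all machines. The goal is to minimize the makespan. Here $m=2$. *)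

theory Defs
  imports Complex_Main "HOL-Library.Landau_Symbols"
begin

section \<open>Scheduling on uniform machines with an incompatibility graph\<close>

text \<open>Jobs are \<open>0, \<dots>, n - 1\<close> and machines are \<open>0, \<dots>, m - 1\<close>.  A schedule is a function
  from jobs to machines; its values outside \<open>{..<n}\<close> are irrelevant.\<close>

definition simple_graph :: "nat set \<Rightarrow> nat set set \<Rightarrow> bool" where
  "simple_graph V E \<longleftrightarrow> (\<forall>e\<in>E. \<exists>u\<in>V. \<exists>v\<in>V. u \<noteq> v \<and> e = {u, v})"

definition bipartite :: "nat set \<Rightarrow> nat set set \<Rightarrow> bool" where
  "bipartite V E \<longleftrightarrow> simple_graph V E \<and>
     (\<exists>A B. A \<union> B = V \<and> A \<inter> B = {} \<and> (\<forall>e\<in>E. \<exists>a\<in>A. \<exists>b\<in>B. e = {a, b}))"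

definition indep_set :: "nat set set \<Rightarrow> nat set \<Rightarrow> bool" where
  "indep_set E S \<longleftrightarrow> (\<forall>u\<in>S. \<forall>v\<in>S. {u, v} \<notin> E)"

definition valid_speeds :: "nat \<Rightarrow> (nat \<Rightarrow> real) \<Rightarrow> bool" where
  "valid_speeds m s \<longleftrightarrow> (\<forall>i<m. s i \<ge> 1) \<and> (\<forall>i j. i \<le> j \<and> j < m \<longrightarrow> s j \<le> s i)"

definition feasible :: "nat \<Rightarrow> nat \<Rightarrow> nat set set \<Rightarrow> (nat \<Rightarrow> nat) \<Rightarrow> bool" where
  "feasible m n E \<sigma> \<longleftrightarrow>
     (\<forall>j<n. \<sigma> j < m) \<and> (\<forall>i<m. indep_set E {j. j < n \<and> \<sigma> j = i})"

definition completion_time ::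
  "nat \<Rightarrow> (nat \<Rightarrow> real) \<Rightarrow> (nat \<Rightarrow> real) \<Rightarrow> (nat \<Rightarrow> nat) \<Rightarrow> nat \<Rightarrow> real" where
  "completion_time n p s \<sigma> i = (\<Sum>j | j < n \<and> \<sigma> j = i. p j / s i)"

definition makespan ::
  "nat \<Rightarrow> nat \<Rightarrow> (nat \<Rightarrow> real) \<Rightarrow> (nat \<Rightarrow> real) \<Rightarrow> (nat \<Rightarrow> nat) \<Rightarrow> real" where
  "makespan m n p s \<sigma> = Max (completion_time n p s \<sigma> ` {..<m})"

definition optimal_schedule ::
  "nat \<Rightarrow> nat \<Rightarrow> nat set set \<Rightarrow> (nat \<Rightarrow> real) \<Rightarrow> (nat \<Rightarrow> real) \<Rightarrow> (nat \<Rightarrow> nat) \<Rightarrow> bool" where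
  "optimal_schedule m n E p s \<sigma> \<longleftrightarrow> feasible m n E \<sigma> \<and>
     (\<forall>\<tau>. feasible m n E \<tau> \<longrightarrow> makespan m n p s \<sigma> \<le> makespan m n p s \<tau>)"


section \<open>The machine model\<close>

text \<open>
  Algorithms are programs of a unit-cost random access machine with structured control flow.
  Memory consists of named arrays of natural numbers and of named arrays of real numbers (a
  program mentions only finitely many names); a scalar is an array used at index 0 only.
  Integer arithmetic is restricted to addition and (truncated) subtraction, as in the RAM of
  Cook and Reckhow, since unit-cost multiplication of unbounded integers would be unreasonably
  powerful.  Real cells are as in the real RAM, with the four field operations and comparison;
  there is no conversion from reals to integers (no rounding), and the only constants
  are natural numbers, so that no information can be hidden in a real constant.
\<close>

type_synonym name = string

record state =
  nats :: "name \<Rightarrow> nat \<Rightarrow> nat"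
  reals :: "name \<Rightarrow> nat \<Rightarrow> real"

datatype nexp =
    NConst nat
  | NGet name nexp
  | NAdd nexp nexp
  | NSub nexp nexp

datatype rexp =
    RConst nat
  | RGet name nexp
  | RAdd rexp rexp
  | RSub rexp rexp
  | RMul rexp rexp
  | RDiv rexp rexp

datatype bexp =
    NLess nexp nexp
  | RLess rexp rexp
  | BNot bexp
  | BAnd bexp bexp

datatype com =
    Skip
  | NPut name nexp nexp
  | RPut name nexp rexp
  | Seq com com
  | Cond bexp com com
  | While bexp com

fun nval :: "nexp \<Rightarrow> state \<Rightarrow> nat" where
  "nval (NConst k) st = k"
| "nval (NGet x e) st = nats st x (nval e st)"
| "nval (NAdd e f) st = nval e st + nval f st"
| "nval (NSub e f) st = nval e st - nval f st"

fun rval :: "rexp \<Rightarrow> state \<Rightarrow> real" where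
  "rval (RConst k) st = real k"
| "rval (RGet x e) st = reals st x (nval e st)"
| "rval (RAdd e f) st = rval e st + rval f st"
| "rval (RSub e f) st = rval e st - rval f st"
| "rval (RMul e f) st = rval e st * rval f st"
| "rval (RDiv e f) st = rval e st / rval f st"

fun bval :: "bexp \<Rightarrow> state \<Rightarrow> bool" where
  "bval (NLess e f) st \<longleftrightarrow> nval e st < nval f st"
| "bval (RLess e f) st \<longleftrightarrow> rval e st < rval f st"
| "bval (BNot b) st \<longleftrightarrow> \<not> bval b st"
| "bval (BAnd b c) st \<longleftrightarrow> bval b st \<and> bval c st"

definition nput :: "name \<Rightarrow> nat \<Rightarrow> nat \<Rightarrow> state \<Rightarrow> state" where
  "nput x k v st = st\<lparr>nats := (nats st)(x := (nats st x)(k := v))\<rparr>"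

definition rput :: "name \<Rightarrow> nat \<Rightarrow> real \<Rightarrow> state \<Rightarrow> state" where
  "rput x k v st = st\<lparr>reals := (reals st)(x := (reals st x)(k := v))\<rparr>"

text \<open>\<open>exec c st t st'\<close>: program \<open>c\<close> started in \<open>st\<close> halts in \<open>st'\<close> after \<open>t\<close> steps.
  Every assignment and every test costs one step; the expressions in it have a size fixed by
  the program, so charging for the single operations would change \<open>t\<close> by a constant factor
  only.\<close>

inductive exec :: "com \<Rightarrow> state \<Rightarrow> nat \<Rightarrow> state \<Rightarrow> bool" where
  exec_Skip: "exec Skip st 1 st"
| exec_NPut: "exec (NPut x i e) st 1 (nput x (nval i st) (nval e st) st)"
| exec_RPut: "exec (RPut x i e) st 1 (rput x (nval i st) (rval e st) st)"
| exec_Seq: "exec c st t st' \<Longrightarrow> exec d st' t' st'' \<Longrightarrow> exec (Seq c d) st (t + t') st''"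
| exec_Cond_True: "bval b st \<Longrightarrow> exec c st t st' \<Longrightarrow> exec (Cond b c d) st (1 + t) st'"
| exec_Cond_False: "\<not> bval b st \<Longrightarrow> exec d st t st' \<Longrightarrow> exec (Cond b c d) st (1 + t) st'"
| exec_While_False: "\<not> bval b st \<Longrightarrow> exec (While b c) st 1 st"
| exec_While_True: "bval b st \<Longrightarrow> exec c st t st' \<Longrightarrow> exec (While b c) st' t' st'' \<Longrightarrow>
    exec (While b c) st (1 + t + t') st''"

inductive_cases exec_SkipE: "exec Skip st t st'"
inductive_cases exec_NPutE: "exec (NPut x i e) st t st'"
inductive_cases exec_RPutE: "exec (RPut x i e) st t st'"
inductive_cases exec_SeqE: "exec (Seq c d) st t st'"
inductive_cases exec_CondE: "exec (Cond b c d) st t st'"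
inductive_cases exec_WhileE: "exec (While b c) st t st'"

lemma exec_deterministic:
  assumes "exec c st t st'" and "exec c st u st''"
  shows "u = t \<and> st'' = st'"
  using assms
proof (induction arbitrary: u st'' rule: exec.induct)
  case exec_Skip then show ?case by (auto elim: exec_SkipE)
next
  case exec_NPut then show ?case by (auto elim: exec_NPutE)
next
  case exec_RPut then show ?case by (auto elim: exec_RPutE)
next
  case (exec_Seq c st t st' d t' st1)
  from exec_Seq.prems show ?case
    by (rule exec_SeqE) (use exec_Seq.IH in metis)
next
  case (exec_Cond_True b st c t st' d)
  from exec_Cond_True.prems show ?case
    by (rule exec_CondE) (use exec_Cond_True.IH exec_Cond_True.hyps in fastforce)+
next
  case (exec_Cond_False b st d t st' c)
  from exec_Cond_False.prems show ?case
    by (rule exec_CondE) (use exec_Cond_False.IH exec_Cond_False.hyps in fastforce)+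
next
  case (exec_While_False b st c)
  from exec_While_False.prems show ?case
    by (rule exec_WhileE) (use exec_While_False.hyps in simp_all)
next
  case (exec_While_True b st c t st' t' st1)
  from exec_While_True.prems show ?case
    by (rule exec_WhileE) (use exec_While_True.IH exec_While_True.hyps in fastforce)+
qed

text \<open>The input consists of the number of jobs in \<open>n[0]\<close>, the row-major 0/1 adjacency matrix
  of the graph in \<open>G[0], \<dots>, G[n * n - 1]\<close> and the speeds in \<open>s[0], \<dots>, s[m - 1]\<close>; all other
  cells are zero.  On termination \<open>out[j]\<close> is the machine of job \<open>j\<close>.  In particular no
  bipartition of the graph is supplied.\<close>

definition input_state :: "nat \<Rightarrow> nat \<Rightarrow> nat set set \<Rightarrow> (nat \<Rightarrow> real) \<Rightarrow> state" where
  "input_state m n E s =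
     \<lparr>nats = (\<lambda>x k. if x = ''n'' \<and> k = 0 then n
                   else if x = ''G'' \<and> k < n * n \<and> {k div n, k mod n} \<in> E then 1
                   else 0),
      reals = (\<lambda>x k. if x = ''s'' \<and> k < m then s k else 0)\<rparr>"

definition output_schedule :: "state \<Rightarrow> nat \<Rightarrow> nat" where
  "output_schedule st = nats st ''out''"

definition solves_Q_bipartite_unit :: "nat \<Rightarrow> com \<Rightarrow> (nat \<Rightarrow> nat) \<Rightarrow> bool" where
  "solves_Q_bipartite_unit m c T \<longleftrightarrow>
     (\<forall>n E s. bipartite {..<n} E \<and> valid_speeds m s \<longrightarrow>
        (\<exists>t st. exec c (input_state m n E s) t st \<and> t \<le> T n \<and>
                optimal_schedule m n E (\<lambda>_. 1) s (output_schedule st)))"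

end

theory Submission
  imports Defs
begin

text \<open>
  Start with every vertex in its own class and, for each edge, merge the classes of its two ends,
  swapping the colours in one of them if the ends agree; relabelling naively costs \<open>n\<close> steps for
  each of the \<open>n\<^sup>2\<close> vertex pairs.  In the end the feasible schedules are exactly
  the colourings obtained by swapping colours on whole classes.  If class \<open>l\<close> has \<open>a l\<close> vertices
  of colour 0 and \<open>b l\<close> of colour 1, the possible loads of machine 0 are the sums with
  one summand from each pair \<open>a l\<close>, \<open>b l\<close>.  The makespan depends on that load only, so a
  subset-sum table with \<open>O(n\<^sup>2)\<close> entries determines the best one, and
  tracing back through the table yields the swaps that attain it.
\<close>

section \<open>Reasoning about programs\<close>

text \<open>Total correctness with a time budget. As \<open>exec\<close> is deterministic, one
  halting run is the only one. The budget is an upper bound, so runs of different length can share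
  it.\<close>

definition wp :: "com \<Rightarrow> nat \<Rightarrow> (state \<Rightarrow> bool) \<Rightarrow> state \<Rightarrow> bool" where
  "wp c t Q st \<longleftrightarrow> (\<exists>t' st'. exec c st t' st' \<and> t' \<le> t \<and> Q st')"

fun nat_writes :: "com \<Rightarrow> name set" where
  "nat_writes Skip = {}"
| "nat_writes (NPut x i e) = {x}"
| "nat_writes (RPut x i e) = {}"
| "nat_writes (Seq c d) = nat_writes c \<union> nat_writes d"
| "nat_writes (Cond b c d) = nat_writes c \<union> nat_writes d"
| "nat_writes (While b c) = nat_writes c"

fun real_writes :: "com \<Rightarrow> name set" where
  "real_writes Skip = {}"
| "real_writes (NPut x i e) = {}"
| "real_writes (RPut x i e) = {x}"
| "real_writes (Seq c d) = real_writes c \<union> real_writes d"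
| "real_writes (Cond b c d) = real_writes c \<union> real_writes d"
| "real_writes (While b c) = real_writes c"

text \<open>A syntactic frame condition: invariants need to mention only the arrays that a program
  changes, since facts about all other arrays carry over from the earlier state.\<close>

definition frame :: "com \<Rightarrow> state \<Rightarrow> state \<Rightarrow> bool" where
  "frame c st st' \<longleftrightarrow> (\<forall>x. x \<notin> nat_writes c \<longrightarrow> nats st' x = nats st x) \<and>
     (\<forall>x. x \<notin> real_writes c \<longrightarrow> reals st' x = reals st x)"

lemma nats_nput [simp]: "nats (nput x k v st) = (nats st)(x := (nats st x)(k := v))"
  and reals_nput [simp]: "reals (nput x k v st) = reals st"
  and nats_rput [simp]: "nats (rput y k r st) = nats st"
  and reals_rput [simp]: "reals (rput y k r st) = (reals st)(y := (reals st y)(k := r))"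
  by (simp_all add: nput_def rput_def)

lemma exec_frame: "exec c st t st' \<Longrightarrow> frame c st st'"
  by (induction rule: exec.induct) (auto simp: frame_def)

lemma frame_nats: "frame c st st' \<Longrightarrow> x \<notin> nat_writes c \<Longrightarrow> nats st' x = nats st x"
  by (simp add: frame_def)

lemma wp_mono: "wp c t P st \<Longrightarrow> (\<And>st'. P st' \<Longrightarrow> Q st') \<Longrightarrow> wp c t Q st"
  unfolding wp_def by blast

text \<open>The second premise offers the frame of \<open>c\<close> besides \<open>P\<close>, so
  intermediate assertions need not repeat what \<open>c\<close> leaves untouched.\<close>

lemma wp_Seq:
  assumes "wp c t P st"
    and "\<And>st'. P st' \<Longrightarrow> frame c st st' \<Longrightarrow> wp d u Q st'"
    and "t + u \<le> T"
  shows "wp (Seq c d) T Q st"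
proof -
  obtain t' st' where c: "exec c st t' st'" "t' \<le> t" "P st'"
    using assms(1) by (auto simp: wp_def)
  obtain u' st'' where d: "exec d st' u' st''" "u' \<le> u" "Q st''"
    using assms(2)[OF c(3) exec_frame[OF c(1)]] by (auto simp: wp_def)
  have "t' + u' \<le> T" using c(2) d(2) assms(3) by linarith
  then show ?thesis using exec_Seq[OF c(1) d(1)] d(3) by (auto simp: wp_def)
qed

lemma wp_Cond:
  assumes "bval b st \<Longrightarrow> wp c t Q st" and "\<not> bval b st \<Longrightarrow> wp d t Q st" and "Suc t \<le> T"
  shows "wp (Cond b c d) T Q st"
proof -
  have "\<exists>t' st'. exec (Cond b c d) st (1 + t') st' \<and> t' \<le> t \<and> Q st'"
    using assms(1,2) unfolding wp_def
    by (cases "bval b st") (metis exec_Cond_True, metis exec_Cond_False)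
  then show ?thesis using assms(3) unfolding wp_def by (metis Suc_le_mono le_trans plus_1_eq_Suc)
qed

section \<open>Loop-free programs as state transformers\<close>

fun loop_free :: "com \<Rightarrow> bool" where
  "loop_free (Seq c d) \<longleftrightarrow> loop_free c \<and> loop_free d"
| "loop_free (Cond b c d) \<longleftrightarrow> loop_free c \<and> loop_free d"
| "loop_free (While b c) \<longleftrightarrow> False"
| "loop_free c \<longleftrightarrow> True"

text \<open>A functional semantics that the simplifier can evaluate, so that loop bodies are
  verified by rewriting. The clause for \<open>While\<close> is a dummy value; \<open>eff\<close> is
  meant for loop-free programs.\<close>

fun eff :: "com \<Rightarrow> state \<Rightarrow> state" where
  "eff Skip st = st"
| "eff (NPut x i e) st = nput x (nval i st) (nval e st) st"
| "eff (RPut x i e) st = rput x (nval i st) (rval e st) st"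
| "eff (Seq c d) st = eff d (eff c st)"
| "eff (Cond b c d) st = (if bval b st then eff c st else eff d st)"
| "eff (While b c) st = st"

fun cost :: "com \<Rightarrow> nat" where
  "cost (Seq c d) = cost c + cost d"
| "cost (Cond b c d) = Suc (max (cost c) (cost d))"
| "cost c = 1"

lemma exec_loop_free: "loop_free c \<Longrightarrow> \<exists>t \<le> cost c. exec c st t (eff c st)"
proof (induction c arbitrary: st)
  case (Seq c d)
  obtain t u where "t \<le> cost c" "exec c st t (eff c st)"
    "u \<le> cost d" "exec d (eff c st) u (eff d (eff c st))"
    using Seq by fastforce
  then show ?case by (auto intro!: exI[of _ "t + u"] exec_Seq)
next
  case (Cond b c d)
  show ?case
  proof (cases "bval b st")
    case True
    obtain t where "t \<le> cost c" "exec c st t (eff c st)" using Cond by fastforce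
    then show ?thesis using True exec_Cond_True[of b st c t] by (auto intro!: exI[of _ "1 + t"])
  next
    case False
    obtain t where "t \<le> cost d" "exec d st t (eff d st)" using Cond by fastforce
    then show ?thesis using False exec_Cond_False[of b st d t] by (auto intro!: exI[of _ "1 + t"])
  qed
qed (auto intro!: exI[of _ 1] exec.intros[simplified])

lemma wp_loop_free: "loop_free c \<Longrightarrow> Q (eff c st) \<Longrightarrow> cost c \<le> t \<Longrightarrow> wp c t Q st"
  unfolding wp_def using exec_loop_free le_trans by blast

section \<open>Counting loops\<close>

abbreviation Var :: "name \<Rightarrow> nexp" where
  "Var x \<equiv> NGet x (NConst 0)"

text \<open>The bound \<open>e\<close> is evaluated anew at each test, so \<open>wp_For\<close>
  demands that its value stay \<open>N\<close> throughout.\<close>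

definition For :: "name \<Rightarrow> nexp \<Rightarrow> com \<Rightarrow> com" where
  "For x e c = Seq (NPut x (NConst 0) (NConst 0))
     (While (NLess (Var x) e) (Seq c (NPut x (NConst 0) (NAdd (Var x) (NConst 1)))))"

lemma writes_For [simp]:
  "nat_writes (For x e c) = insert x (nat_writes c)" "real_writes (For x e c) = real_writes c"
  by (auto simp: For_def)

text \<open>Each pass costs a test, the body and an increment, hence \<open>t + 2\<close>; the final
  \<open>+ 2\<close> pays for the initialisation and the failing test. The invariant is asserted
  once the counter has been set, and the frame is that of the whole loop relative to the state
  before it, so it is available in every pass.\<close>

lemma wp_For:
  assumes x: "x \<notin> nat_writes c"
    and e: "\<And>st'. frame (For x e c) st st' \<Longrightarrow> nval e st' = N"
    and init: "I 0 (nput x 0 0 st)"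
    and step: "\<And>k st'. k < N \<Longrightarrow> nats st' x 0 = k \<Longrightarrow> frame (For x e c) st st' \<Longrightarrow> I k st' \<Longrightarrow>
      wp c t (\<lambda>st''. I (Suc k) (nput x 0 (Suc k) st'')) st'"
    and fin: "\<And>st'. I N st' \<Longrightarrow> Q st'"
    and T: "N * (t + 2) + 2 \<le> T"
  shows "wp (For x e c) T Q st"
proof -
  let ?b = "NLess (Var x) e" and ?c = "Seq c (NPut x (NConst 0) (NAdd (Var x) (NConst 1)))"
  \<comment> \<open>The claim is generalised to a loop entered at counter value \<open>k\<close>,
    for induction on the number \<open>N - k\<close> of passes left.\<close>
  have loop: "\<exists>t' st''. exec (While ?b ?c) st' t' st'' \<and> t' \<le> (N - k) * (t + 2) + 1 \<and> Q st''"
    if "k \<le> N" "nats st' x 0 = k" "frame (For x e c) st st'" "I k st'" for k st'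
    using that
  proof (induction "N - k" arbitrary: k st')
    case 0
    then have "\<not> bval ?b st'" "Q st'" using e fin by auto
    then show ?case using exec_While_False[of ?b st' ?c] by fastforce
  next
    case (Suc d)
    then have k: "k < N" by simp
    obtain t1 st1 where 1: "exec c st' t1 st1" "t1 \<le> t" "I (Suc k) (nput x 0 (Suc k) st1)"
      using step[OF k Suc.prems(2-4)] by (auto simp: wp_def)
    define st2 where "st2 = nput x 0 (Suc k) st1"
    have fr: "frame c st' st1" by (rule exec_frame[OF 1(1)])
    have "nats st1 x 0 = k" using frame_nats[OF fr x] Suc.prems(2) by simp
    then have body: "exec ?c st' (t1 + 1) st2"
      using exec_Seq[OF 1(1) exec_NPut[of x "NConst 0" "NAdd (Var x) (NConst 1)"]]
      by (simp add: st2_def)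
    have "frame (For x e c) st st2" using fr Suc.prems(3) by (auto simp: frame_def st2_def)
    then obtain t' st'' where w: "exec (While ?b ?c) st2 t' st''"
        "t' \<le> (N - Suc k) * (t + 2) + 1" "Q st''"
      using Suc.hyps(1)[of "Suc k" st2] Suc.hyps(2) k 1(3)
      unfolding st2_def by fastforce
    have b: "bval ?b st'" using e[OF Suc.prems(3)] Suc.prems(2) k by simp
    have "(N - k) * (t + 2) = (N - Suc k) * (t + 2) + (t + 2)"
      using k by (metis Suc_diff_Suc add.commute mult_Suc)
    then have "1 + (t1 + 1) + t' \<le> (N - k) * (t + 2) + 1" using w(2) 1(2) by linarith
    then show ?case using exec_While_True[OF b body w(1)] w(3) by blast
  qed
  obtain t' st'' where "exec (While ?b ?c) (nput x 0 0 st) t' st''" "t' \<le> N * (t + 2) + 1" "Q st''"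
    using loop[of 0 "nput x 0 0 st"] init by (auto simp: frame_def)
  then show ?thesis
    using exec_Seq[OF exec_NPut[of x "NConst 0" "NConst 0" st, simplified]] T
    unfolding wp_def For_def by fastforce
qed

section \<open>Feasible schedules on two machines\<close>

lemma feasible_2_iff:
  "feasible 2 n E \<tau> \<longleftrightarrow>
     (\<forall>j<n. \<tau> j < 2) \<and> (\<forall>u<n. \<forall>v<n. {u, v} \<in> E \<longrightarrow> \<tau> u \<noteq> \<tau> v)"
  unfolding feasible_def indep_set_def by (auto, metis)

text \<open>The two sides of a bipartition serve as machines. A feasible schedule is needed twice
  later: it rules out an edge between equal colours within one class, and it provides an attainable
  load.\<close>

lemma bipartite_feasible:
  assumes "bipartite {..<n} E"
  shows "\<exists>\<tau>. feasible 2 n E \<tau>"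
proof -
  obtain A B where "A \<inter> B = {}" and E: "\<forall>e\<in>E. \<exists>a\<in>A. \<exists>b\<in>B. e = {a, b}"
    using assms unfolding bipartite_def by blast
  then have "\<forall>u v. {u, v} \<in> E \<longrightarrow> (u \<in> A \<longleftrightarrow> v \<notin> A)"
    by (metis disjoint_iff doubleton_eq_iff)
  then have "feasible 2 n E (\<lambda>v. if v \<in> A then 0 else 1)"
    unfolding feasible_2_iff by auto
  then show ?thesis by blast
qed

text \<open>The makespan when \<open>k\<close> unit jobs run on machine 0 and the remaining ones on
  machine 1.\<close>

definition load_cost :: "nat \<Rightarrow> (nat \<Rightarrow> real) \<Rightarrow> nat \<Rightarrow> real" where
  "load_cost n s k = max (real k / s 0) (real (n - k) / s 1)"

lemma makespan_2:
  assumes "\<forall>j<n. \<sigma> j < 2"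
  shows "makespan 2 n (\<lambda>_. 1) s \<sigma> = load_cost n s (card {j. j < n \<and> \<sigma> j = 0})"
proof -
  let ?A = "{j. j < n \<and> \<sigma> j = 0}" and ?B = "{j. j < n \<and> \<sigma> j = 1}"
  have "?A \<union> ?B = {..<n}" using assms by (auto simp: less_2_cases_iff)
  moreover have "card (?A \<union> ?B) = card ?A + card ?B" by (rule card_Un_disjoint) auto
  ultimately have "card ?B = n - card ?A" by simp
  moreover have "{..<2::nat} = {0, 1}" by auto
  ultimately show ?thesis by (simp add: makespan_def completion_time_def load_cost_def)
qed

text \<open>The third conjunct says that the vertices with one label are already forced, up to a
  global swap, in every feasible schedule; this replaces any mention of connectivity.\<close>

definition forced_colouring ::
  "nat \<Rightarrow> nat set set \<Rightarrow> (nat \<times> nat) set \<Rightarrow> (nat \<Rightarrow> nat) \<Rightarrow> (nat \<Rightarrow> nat) \<Rightarrow> bool" where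
  "forced_colouring n E P lab col \<longleftrightarrow>
     (\<forall>v<n. lab v < n \<and> col v < 2) \<and>
     (\<forall>(u, v)\<in>P. {u, v} \<in> E \<longrightarrow> lab u = lab v \<and> col u \<noteq> col v) \<and>
     (\<forall>\<tau>. feasible 2 n E \<tau> \<longrightarrow>
        (\<forall>u<n. \<forall>v<n. lab u = lab v \<longrightarrow> (\<tau> u = \<tau> v \<longleftrightarrow> col u = col v)))"

text \<open>Each class is already rigid up to a swap. The new edge forces
  \<open>\<tau> u \<noteq> \<tau> v\<close>, which fixes the orientation of the two classes relative
  to each other; so the union is rigid once the class of \<open>v\<close> is swapped whenever
  \<open>u\<close> and \<open>v\<close> agree.\<close>

lemma forced_colouring_merge:
  assumes inv: "forced_colouring n E P lab col"
    and P: "P \<subseteq> {..<n} \<times> {..<n}"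
    and uv: "u < n" "v < n" "{u, v} \<in> E"
    and ex: "\<exists>\<tau>. feasible 2 n E \<tau>"
    and lab': "\<And>w. w < n \<Longrightarrow> lab' w = (if lab w = lab v then lab u else lab w)"
    and col': "\<And>w. w < n \<Longrightarrow>
      col' w = (if lab w = lab v \<and> col u = col v then 1 - col w else col w)"
  shows "forced_colouring n E (insert (u, v) P) lab' col'"
proof -
  have rng: "lab w < n" "col w < 2" if "w < n" for w
    using inv that by (auto simp: forced_colouring_def)
  have edge: "lab x = lab y \<and> col x \<noteq> col y" if "(x, y) \<in> P" "{x, y} \<in> E" for x y
    using inv that by (auto simp: forced_colouring_def)
  have forced: "\<tau> x = \<tau> y \<longleftrightarrow> col x = col y"
    if "feasible 2 n E \<tau>" "x < n" "y < n" "lab x = lab y" for \<tau> x y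
    using inv that by (auto simp: forced_colouring_def)
  have feas: "\<tau> u \<noteq> \<tau> v" "\<And>w. w < n \<Longrightarrow> \<tau> w < 2" if "feasible 2 n E \<tau>" for \<tau>
    using that uv by (auto simp: feasible_2_iff)
  \<comment> \<open>Some feasible schedule separates \<open>u\<close> and \<open>v\<close>; if they
    share a class, rigidity transfers this to \<open>col\<close>. Merging a class with itself
    therefore swaps nothing.\<close>
  have same: "col u \<noteq> col v" if "lab u = lab v"
    using ex forced feas uv(1,2) that by metis
  have c01: "col w = 0 \<or> col w = 1" if "w < n" for w using rng(2)[OF that] by linarith
  have "lab' x = lab' y \<and> col' x \<noteq> col' y" if "(x, y) \<in> insert (u, v) P" "{x, y} \<in> E" for x y
  proof (cases "(x, y) = (u, v)")
    case True
    then show ?thesis using lab' col' uv same c01[of u] c01[of v] by auto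
  next
    case False
    then have "(x, y) \<in> P" "x < n" "y < n" using that P by auto
    \<comment> \<open>The ends of an older edge share a class, so they are relabelled and swapped
      together.\<close>
    then show ?thesis using edge[OF _ that(2)] lab' col' c01[of x] c01[of y] by auto
  qed
  moreover have "\<tau> x = \<tau> y \<longleftrightarrow> col' x = col' y"
    if \<tau>: "feasible 2 n E \<tau>" and xy: "x < n" "y < n" "lab' x = lab' y" for \<tau> x y
  proof -
    have t01: "\<tau> w = 0 \<or> \<tau> w = 1" if "w < n" for w using feas(2)[OF \<tau> that] by linarith
    \<comment> \<open>Vertices from different classes are compared through \<open>v\<close> and
      \<open>u\<close>, which \<open>\<tau>\<close> separates; as all values are 0 or 1, the rest is
      a finite case check.\<close>
    have diff: "\<tau> p = \<tau> q \<longleftrightarrow> (if col u = col v then 1 - col p else col p) = col q"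
      if "p < n" "q < n" "lab p = lab v" "lab q = lab u" for p q
    proof -
      have "\<tau> p = \<tau> v \<longleftrightarrow> col p = col v" "\<tau> q = \<tau> u \<longleftrightarrow> col q = col u"
        using forced[OF \<tau>] that uv by auto
      then show ?thesis
        using feas(1)[OF \<tau>] t01[OF that(1)] t01[OF that(2)] t01[OF uv(1)] t01[OF uv(2)]
          c01[OF that(1)] c01[OF that(2)] c01[OF uv(1)] c01[OF uv(2)]
        by (elim disjE) simp_all
    qed
    show ?thesis
    proof (cases "lab x = lab v"; cases "lab y = lab v")
      assume "lab x = lab v" "lab y = lab v"
      then show ?thesis
        using forced[OF \<tau> xy(1,2)] col' xy(1,2) c01[OF xy(1)] c01[OF xy(2)] by auto
    next
      assume *: "lab x = lab v" "lab y \<noteq> lab v"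
      then have "lab y = lab u" using xy lab' by simp
      then show ?thesis using diff[of x y] * xy col' by simp
    next
      assume *: "lab x \<noteq> lab v" "lab y = lab v"
      then have "lab x = lab u" using xy lab' by simp
      then show ?thesis using diff[of y x] * xy col' by (metis (full_types))
    next
      assume "lab x \<noteq> lab v" "lab y \<noteq> lab v"
      then show ?thesis using forced[OF \<tau> xy(1,2)] xy lab' col' by simp
    qed
  qed
  moreover have "lab' w < n \<and> col' w < 2" if "w < n" for w
    using lab'[OF that] col'[OF that] rng[OF that] rng[OF uv(1)] by auto
  ultimately show ?thesis unfolding forced_colouring_def by auto
qed

section \<open>Attainable loads\<close>

text \<open>The guards prevent truncated subtraction from turning an overshoot into the load
  0.\<close>

fun attain :: "(nat \<Rightarrow> nat) \<Rightarrow> (nat \<Rightarrow> nat) \<Rightarrow> nat \<Rightarrow> nat \<Rightarrow> bool" where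
  "attain a b 0 k \<longleftrightarrow> k = 0"
| "attain a b (Suc l) k \<longleftrightarrow>
     a l \<le> k \<and> attain a b l (k - a l) \<or> b l \<le> k \<and> attain a b l (k - b l)"

text \<open>Every selection yields an attainable load. The converse, a selection for a given
  attainable load, is what the trace-back program computes.\<close>

lemma attain_sum: "attain a b l (\<Sum>i<l. if f i then b i else a i)"
  by (induction l) auto

text \<open>The vertex bound is a parameter so that \<open>class_size k\<close> can serve as the
  invariant after \<open>k\<close> vertices have been counted.\<close>

definition class_size :: "nat \<Rightarrow> (nat \<Rightarrow> nat) \<Rightarrow> (nat \<Rightarrow> nat) \<Rightarrow> nat \<Rightarrow> nat \<Rightarrow> nat" where
  "class_size n lab col c l = card {v. v < n \<and> lab v = l \<and> col v = c}"

lemma class_size_Suc: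
  "class_size (Suc k) lab col c l =
     class_size k lab col c l + (if lab k = l \<and> col k = c then 1 else 0)"
proof -
  have "{v. v < Suc k \<and> lab v = l \<and> col v = c} =
    (if lab k = l \<and> col k = c then insert k {v. v < k \<and> lab v = l \<and> col v = c}
     else {v. v < k \<and> lab v = l \<and> col v = c})"
    by (auto simp: less_Suc_eq)
  then show ?thesis by (simp add: class_size_def)
qed

text \<open>Split the jobs on machine 0 by label: a swapped class contributes its vertices of colour
  1, any other class those of colour 0.\<close>

lemma card_machine_0:
  assumes "\<forall>v<n. lab v < n \<and> col v < 2"
    and "\<And>v. v < n \<Longrightarrow> \<sigma> v = (if f (lab v) then 1 - col v else col v)"
  shows "card {v. v < n \<and> \<sigma> v = 0} =
    (\<Sum>l<n. if f l then class_size n lab col 1 l else class_size n lab col 0 l)"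
proof -
  have "{v. v < n \<and> \<sigma> v = 0} =
      (\<Union>l<n. {v. v < n \<and> lab v = l \<and> col v = (if f l then 1 else 0)})"
    using assms by (fastforce simp: less_2_cases_iff)
  also have "card \<dots> = (\<Sum>l<n. card {v. v < n \<and> lab v = l \<and> col v = (if f l then 1 else 0)})"
    by (rule card_UN_disjoint) auto
  also have "\<dots> = (\<Sum>l<n. if f l then class_size n lab col 1 l else class_size n lab col 0 l)"
    by (rule sum.cong) (auto simp: class_size_def)
  finally show ?thesis .
qed

text \<open>Every edge lies within one class, and a swap of the whole class keeps its two ends
  distinct.\<close>

lemma feasible_flip:
  assumes "forced_colouring n E ({..<n} \<times> {..<n}) lab col"
    and "\<And>v. v < n \<Longrightarrow> \<sigma> v = (if f (lab v) then 1 - col v else col v)"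
  shows "feasible 2 n E \<sigma>"
proof -
  have "\<sigma> v < 2" if "v < n" for v
    using assms that by (auto simp: forced_colouring_def)
  moreover have "\<sigma> u \<noteq> \<sigma> v" if "u < n" "v < n" "{u, v} \<in> E" for u v
  proof -
    have "lab u = lab v" "col u \<noteq> col v" "col u < 2" "col v < 2"
      using assms(1) that by (auto simp: forced_colouring_def)
    then show ?thesis using assms(2) that by auto
  qed
  ultimately show ?thesis by (simp add: feasible_2_iff)
qed

text \<open>By rigidity, a schedule that differs from \<open>col\<close> at one vertex differs from
  it on the whole class. So \<open>\<tau>\<close> arises from \<open>col\<close> by swapping the
  classes in \<open>f\<close>, and its load is a sum of selected class sizes.\<close>

lemma feasible_attain:
  assumes inv: "forced_colouring n E P lab col" and \<tau>: "feasible 2 n E \<tau>"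
  shows "attain (class_size n lab col 0) (class_size n lab col 1) n (card {v. v < n \<and> \<tau> v = 0})"
proof -
  define f where "f l \<longleftrightarrow> (\<exists>v<n. lab v = l \<and> \<tau> v \<noteq> col v)" for l
  have rng: "lab v < n \<and> col v < 2 \<and> \<tau> v < 2" if "v < n" for v
    using inv \<tau> that by (auto simp: forced_colouring_def feasible_2_iff)
  have "\<tau> v = (if f (lab v) then 1 - col v else col v)" if v: "v < n" for v
  proof (cases "f (lab v)")
    case True
    then obtain w where w: "w < n" "lab w = lab v" "\<tau> w \<noteq> col w" by (auto simp: f_def)
    then have "\<tau> w = \<tau> v \<longleftrightarrow> col w = col v"
      using inv \<tau> v by (auto simp: forced_colouring_def)
    then show ?thesis using rng[OF v] rng[OF w(1)] w(3) True by auto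
  next
    case False
    then show ?thesis using v by (auto simp: f_def)
  qed
  then have "card {v. v < n \<and> \<tau> v = 0} =
      (\<Sum>l<n. if f l then class_size n lab col 1 l else class_size n lab col 0 l)"
    using rng by (intro card_machine_0) auto
  then show ?thesis using attain_sum by metis
qed

text \<open>Row-major indexing with rows of length \<open>n + 1\<close>, written so that it is
  computable from the tabulated products \<open>l * n\<close> by additions alone.\<close>

definition cell :: "nat \<Rightarrow> nat \<Rightarrow> nat \<Rightarrow> nat" where
  "cell n l k = l * n + l + k"

text \<open>Division by \<open>Suc n\<close> recovers the row because the column is at most
  \<open>n\<close>.\<close>

lemma cell_inject: "k \<le> n \<Longrightarrow> k' \<le> n \<Longrightarrow> cell n l k = cell n l' k' \<longleftrightarrow> l = l' \<and> k = k'"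
proof -
  assume *: "k \<le> n" "k' \<le> n"
  have d: "(l * Suc n + k) div Suc n = l" if "k \<le> n" for l k
    using that by (simp add: div_mult_self3 less_Suc_eq_le del: mult_Suc_right)
  have "cell n l k = l * Suc n + k" for l k by (simp add: cell_def)
  then show ?thesis using * d by (metis add_left_cancel)
qed

section \<open>The program\<close>

abbreviation NEq :: "nexp \<Rightarrow> nexp \<Rightarrow> bexp" where
  "NEq e f \<equiv> BAnd (BNot (NLess e f)) (BNot (NLess f e))"

text \<open>The machine can neither multiply integers nor convert them to reals, so the products
  \<open>l * n\<close> and the reals \<open>0, \<dots>, n\<close> are tabulated in \<open>row\<close> and \<open>r\<close>.\<close>

definition init_prog :: com where
  "init_prog = For ''i'' (Var ''n'')
     (Seq (NPut ''lab'' (Var ''i'') (Var ''i''))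
     (Seq (NPut ''row'' (NAdd (Var ''i'') (NConst 1)) (NAdd (NGet ''row'' (Var ''i'')) (Var ''n'')))
          (RPut ''r'' (NAdd (Var ''i'') (NConst 1)) (RAdd (RGet ''r'' (Var ''i'')) (RConst 1)))))"

text \<open>If the two ends already share a label, their colours differ and the merge changes
  nothing, so no test for this is needed.\<close>

definition merge_prog :: com where
  "merge_prog =
     Seq (NPut ''lu'' (NConst 0) (NGet ''lab'' (Var ''u'')))
    (Seq (NPut ''lv'' (NConst 0) (NGet ''lab'' (Var ''v'')))
    (Seq (Cond (NEq (NGet ''col'' (Var ''u'')) (NGet ''col'' (Var ''v'')))
            (NPut ''flip'' (NConst 0) (NConst 1)) (NPut ''flip'' (NConst 0) (NConst 0)))
         (For ''w'' (Var ''n'')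
            (Cond (NEq (NGet ''lab'' (Var ''w'')) (Var ''lv''))
               (Seq (NPut ''lab'' (Var ''w'') (Var ''lu''))
                    (Cond (NLess (NConst 0) (Var ''flip''))
                       (NPut ''col'' (Var ''w'') (NSub (NConst 1) (NGet ''col'' (Var ''w'')))) Skip))
               Skip))))"

definition link_prog :: com where
  "link_prog = For ''u'' (Var ''n'') (For ''v'' (Var ''n'')
     (Cond (NLess (NConst 0) (NGet ''G'' (NAdd (NGet ''row'' (Var ''u'')) (Var ''v''))))
        merge_prog Skip))"

definition count_prog :: com where
  "count_prog = For ''v'' (Var ''n'')
     (Cond (NLess (NConst 0) (NGet ''col'' (Var ''v'')))
        (NPut ''b'' (NGet ''lab'' (Var ''v'')) (NAdd (NGet ''b'' (NGet ''lab'' (Var ''v''))) (NConst 1)))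
        (NPut ''a'' (NGet ''lab'' (Var ''v'')) (NAdd (NGet ''a'' (NGet ''lab'' (Var ''v''))) (NConst 1))))"

definition cell_exp :: "nexp \<Rightarrow> nexp \<Rightarrow> nexp" where
  "cell_exp l k = NAdd (NAdd (NGet ''row'' l) l) k"

text \<open>The program form of one disjunct in the recursion of \<open>attain\<close>, with
  \<open>x\<close> naming the array \<open>a\<close> or \<open>b\<close>. Filling the table and
  tracing back share it.\<close>

definition via :: "name \<Rightarrow> nexp \<Rightarrow> nexp \<Rightarrow> bexp" where
  "via x l k = BAnd (BNot (NLess k (NGet x l)))
     (NLess (NConst 0) (NGet ''D'' (cell_exp l (NSub k (NGet x l)))))"

text \<open>Cells are only ever set to 1; an unattainable load is recorded by the initial
  zero.\<close>

definition table_prog :: com where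
  "table_prog = Seq (NPut ''D'' (NConst 0) (NConst 1))
     (For ''l'' (Var ''n'') (For ''k'' (NAdd (Var ''n'') (NConst 1))
        (Seq (Cond (via ''a'' (Var ''l'') (Var ''k''))
                (NPut ''D'' (cell_exp (NAdd (Var ''l'') (NConst 1)) (Var ''k'')) (NConst 1)) Skip)
             (Cond (via ''b'' (Var ''l'') (Var ''k''))
                (NPut ''D'' (cell_exp (NAdd (Var ''l'') (NConst 1)) (Var ''k'')) (NConst 1)) Skip))))"

definition choose_step :: com where
  "choose_step =
     Seq (RPut ''c'' (NConst 0) (RDiv (RGet ''r'' (Var ''k'')) (RGet ''s'' (NConst 0))))
    (Seq (RPut ''d'' (NConst 0)
            (RDiv (RGet ''r'' (NSub (Var ''n'') (Var ''k''))) (RGet ''s'' (NConst 1))))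
    (Seq (Cond (RLess (RGet ''c'' (NConst 0)) (RGet ''d'' (NConst 0)))
            (RPut ''c'' (NConst 0) (RGet ''d'' (NConst 0))) Skip)
         (Cond (RLess (RGet ''c'' (NConst 0)) (RGet ''best'' (NConst 0)))
            (Seq (RPut ''best'' (NConst 0) (RGet ''c'' (NConst 0)))
                 (NPut ''cur'' (NConst 0) (Var ''k'')))
            Skip)))"

definition choose_prog :: com where
  "choose_prog = Seq (RPut ''best'' (NConst 0) (RAdd (RGet ''r'' (Var ''n'')) (RConst 1)))
     (For ''k'' (NAdd (Var ''n'') (NConst 1))
        (Cond (NLess (NConst 0) (NGet ''D'' (cell_exp (Var ''n'') (Var ''k'')))) choose_step Skip))"

text \<open>Classes are visited from the last to the first, with \<open>cur\<close> the load still
  to be made up. If colour 0 cannot be chosen for class \<open>l\<close>, attainability guarantees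
  the other choice, so a single test suffices.\<close>

definition trace_prog :: com where
  "trace_prog = For ''i'' (Var ''n'')
     (Seq (NPut ''l'' (NConst 0) (NSub (NSub (Var ''n'') (NConst 1)) (Var ''i'')))
          (Cond (via ''a'' (Var ''l'') (Var ''cur''))
             (NPut ''cur'' (NConst 0) (NSub (Var ''cur'') (NGet ''a'' (Var ''l''))))
             (Seq (NPut ''swap'' (Var ''l'') (NConst 1))
                  (NPut ''cur'' (NConst 0) (NSub (Var ''cur'') (NGet ''b'' (Var ''l'')))))))"

definition output_prog :: com where
  "output_prog = For ''v'' (Var ''n'')
     (Cond (NLess (NConst 0) (NGet ''swap'' (NGet ''lab'' (Var ''v''))))
        (NPut ''out'' (Var ''v'') (NSub (NConst 1) (NGet ''col'' (Var ''v''))))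
        (NPut ''out'' (Var ''v'') (NGet ''col'' (Var ''v''))))"

definition solver :: com where
  "solver = Seq init_prog (Seq link_prog (Seq count_prog (Seq table_prog
     (Seq choose_prog (Seq trace_prog output_prog)))))"

section \<open>Correctness and cost of building the forced colouring\<close>

lemma wp_init:
  assumes "nats st ''n'' 0 = n" "nats st ''row'' 0 = 0" "reals st ''r'' 0 = 0"
  shows "wp init_prog (5 * n + 2) (\<lambda>st. (\<forall>v<n. nats st ''lab'' v = v) \<and>
    (\<forall>l\<le>n. nats st ''row'' l = l * n) \<and> (\<forall>k\<le>n. reals st ''r'' k = real k)) st"
  unfolding init_prog_def
\<comment> \<open>Pass \<open>k\<close> writes \<open>lab\<close> at \<open>k\<close> but
  \<open>row\<close> and \<open>r\<close> at \<open>k + 1\<close>, hence the different ranges; entry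
  0 of \<open>row\<close> and \<open>r\<close> is the initial zero.\<close>
proof (rule wp_For[where N = n and t = 3 and
      I = "\<lambda>k st. (\<forall>v<k. nats st ''lab'' v = v) \<and> (\<forall>l\<le>k. nats st ''row'' l = l * n) \<and>
        (\<forall>j\<le>k. reals st ''r'' j = real j)"], goal_cases)
  case (4 k st')
  have "nats st' ''n'' 0 = n" using 4 assms by (simp add: frame_def)
  then show ?case using 4 by (intro wp_loop_free) (auto simp: less_Suc_eq le_Suc_eq)
qed (use assms in \<open>auto simp: frame_def\<close>)

text \<open>The labels and the swap flag are cached because the loop overwrites the entries of
  \<open>v\<close> itself. Each pass then reads only its own vertex and the cached scalars, so the
  outcome is expressible in the old arrays.\<close>

lemma wp_merge:
  assumes "nats st ''n'' 0 = n" "nats st ''u'' 0 = u" "nats st ''v'' 0 = v"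
    "nats st ''lab'' = lab" "nats st ''col'' = col"
  shows "wp merge_prog (6 * n + 6) (\<lambda>st. \<forall>w<n.
      nats st ''lab'' w = (if lab w = lab v then lab u else lab w) \<and>
      nats st ''col'' w = (if lab w = lab v \<and> col u = col v then 1 - col w else col w)) st"
  unfolding merge_prog_def
  apply (rule wp_Seq[where t = 1 and u = "6 * n + 5" and P = "\<lambda>st. nats st ''lu'' 0 = lab u"])
    apply (rule wp_loop_free; use assms in simp)
   apply (rule wp_Seq[where t = 1 and u = "6 * n + 4" and
        P = "\<lambda>st. nats st ''lu'' 0 = lab u \<and> nats st ''lv'' 0 = lab v"])
     apply (rule wp_loop_free; use assms in \<open>simp add: frame_def\<close>)
    apply (rule wp_Seq[where t = 2 and u = "6 * n + 2" and
        P = "\<lambda>st. nats st ''lu'' 0 = lab u \<and> nats st ''lv'' 0 = lab v \<and>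
          nats st ''flip'' 0 = (if col u = col v then 1 else 0)"])
      apply (rule wp_loop_free; use assms in \<open>simp add: frame_def\<close>)
  subgoal for st1 st2 st3
  proof (rule wp_For[where N = n and t = 4 and I = "\<lambda>k st. \<forall>w<n.
      nats st ''lab'' w = (if w < k \<and> lab w = lab v then lab u else lab w) \<and>
      nats st ''col'' w =
        (if w < k \<and> lab w = lab v \<and> col u = col v then 1 - col w else col w)"], goal_cases)
    case (4 k st')
    have "nats st' ''lu'' 0 = lab u" "nats st' ''lv'' 0 = lab v"
      "nats st' ''flip'' 0 = (if col u = col v then 1 else 0)"
      using 4 by (auto simp: frame_def)
    then show ?case using 4 by (intro wp_loop_free) (auto simp: less_Suc_eq)
  qed (use assms in \<open>auto simp: frame_def\<close>)
    apply simp_all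
  done

text \<open>This is the cubic phase: each of the \<open>n * n\<close> pairs may cause a relabelling
  pass over all vertices. Initially every class is a singleton, which is trivially rigid.\<close>

lemma wp_link:
  assumes n: "nats st ''n'' 0 = n" and row: "\<forall>l\<le>n. nats st ''row'' l = l * n"
    and G: "\<And>u v. u < n \<Longrightarrow> v < n \<Longrightarrow> nats st ''G'' (u * n + v) > 0 \<longleftrightarrow> {u, v} \<in> E"
    and lab: "\<forall>v<n. nats st ''lab'' v = v" and col: "\<forall>v<n. nats st ''col'' v = 0"
    and ex: "\<exists>\<tau>. feasible 2 n E \<tau>"
  shows "wp link_prog (n * (n * (6 * n + 9) + 4) + 2)
    (\<lambda>st. forced_colouring n E ({..<n} \<times> {..<n}) (nats st ''lab'') (nats st ''col'')) st"
  unfolding link_prog_def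
proof (rule wp_For[where N = n and t = "n * (6 * n + 9) + 2" and
      I = "\<lambda>i st. forced_colouring n E ({..<i} \<times> {..<n}) (nats st ''lab'') (nats st ''col'')"],
      goal_cases)
  case (2 st')
  then show ?case using n by (simp add: frame_def merge_prog_def)
next
  case (4 i st1)
  \<comment> \<open>The pairs that precede \<open>(i, j)\<close> in the row-major order of the
    double loop.\<close>
  let ?P = "\<lambda>j. {..<i} \<times> {..<n} \<union> {i} \<times> {..<j}"
  have st1: "nats st1 ''n'' 0 = n" "nats st1 ''row'' = nats st ''row''" "nats st1 ''G'' = nats st ''G''"
    using 4(3) n by (simp_all add: frame_def merge_prog_def)
  show ?case
  proof (rule wp_For[where N = n and t = "6 * n + 7" and
      I = "\<lambda>j st. forced_colouring n E (?P j) (nats st ''lab'') (nats st ''col'')"], goal_cases)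
    case (2 st')
    then show ?case using st1 by (simp add: frame_def merge_prog_def)
  next
    case (3)
    then show ?case using 4 by simp
  next
    case (4 j st2)
    have st2: "nats st2 ''n'' 0 = n" "nats st2 ''row'' = nats st ''row''"
      "nats st2 ''G'' = nats st ''G''" "nats st2 ''u'' 0 = i"
      using 4(3) st1 \<open>nats st1 ''u'' 0 = i\<close> by (simp_all add: frame_def merge_prog_def)
    have P: "?P (Suc j) = insert (i, j) (?P j)" "?P j \<subseteq> {..<n} \<times> {..<n}"
      using \<open>i < n\<close> \<open>j < n\<close> by auto
    have test: "0 < nats st2 ''G'' (nats st2 ''row'' i + j) \<longleftrightarrow> {i, j} \<in> E"
      using G[OF \<open>i < n\<close> \<open>j < n\<close>] row \<open>i < n\<close> by (simp add: st2)
    show ?case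
    proof (rule wp_Cond[where t = "6 * n + 6"], goal_cases)
      case 1
      then have E: "{i, j} \<in> E" using test 4 by (simp add: st2)
      have "forced_colouring n E (?P (Suc j)) lab col"
        if "\<forall>w<n. lab w = (if nats st2 ''lab'' w = nats st2 ''lab'' j then nats st2 ''lab'' i
              else nats st2 ''lab'' w) \<and>
            col w = (if nats st2 ''lab'' w = nats st2 ''lab'' j \<and>
              nats st2 ''col'' i = nats st2 ''col'' j then 1 - nats st2 ''col'' w
              else nats st2 ''col'' w)" for lab col
        unfolding P(1)
        by (rule forced_colouring_merge[OF 4(4) P(2) \<open>i < n\<close> \<open>j < n\<close> E ex]) (use that in auto)
      then show ?case by (intro wp_mono[OF wp_merge[OF st2(1) st2(4) 4(2) refl refl]]) simp
    next
      case 2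
      then have "{i, j} \<notin> E" using test 4 by (simp add: st2)
      then have "forced_colouring n E (?P (Suc j)) (nats st2 ''lab'') (nats st2 ''col'')"
        using 4(4) unfolding P(1) by (auto simp: forced_colouring_def)
      then show ?case by (intro wp_loop_free) simp_all
    qed simp
  next
    case (5 st')
    moreover have "?P n = {..<Suc i} \<times> {..<n}" by auto
    ultimately show ?case by simp
  qed (auto simp: merge_prog_def)
next
  case 6
  show ?case by (simp add: algebra_simps)
qed (use assms in \<open>auto simp: merge_prog_def forced_colouring_def\<close>)

lemma wp_count:
  assumes n: "nats st ''n'' 0 = n" and lab: "nats st ''lab'' = lab" and col: "nats st ''col'' = col"
    and "\<forall>v<n. lab v < n \<and> col v < 2" and "\<forall>l. nats st ''a'' l = 0 \<and> nats st ''b'' l = 0"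
  shows "wp count_prog (4 * n + 2) (\<lambda>st.
    nats st ''a'' = class_size n lab col 0 \<and> nats st ''b'' = class_size n lab col 1) st"
  unfolding count_prog_def
proof (rule wp_For[where N = n and t = 2 and I = "\<lambda>k st.
    nats st ''a'' = class_size k lab col 0 \<and> nats st ''b'' = class_size k lab col 1"], goal_cases)
  case (4 k st')
  have "nats st' ''lab'' = lab" "nats st' ''col'' = col" using 4 assms by (simp_all add: frame_def)
  moreover have "col k = 0 \<or> col k = 1" using 4(1) assms(4) by (auto simp: less_2_cases_iff)
  ultimately show ?case using 4
    by (intro wp_loop_free) (auto simp: class_size_Suc fun_eq_iff)
qed (use assms in \<open>auto simp: frame_def class_size_def fun_eq_iff\<close>)

section \<open>Correctness and cost of the subset-sum table, the choice of a load and the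
  trace-back\<close>

lemma nval_cell_exp:
  "nats st ''row'' (nval l st) = nval l st * n \<Longrightarrow>
     nval (cell_exp l k) st = cell n (nval l st) (nval k st)"
  by (simp add: cell_exp_def cell_def)

lemma bval_via:
  "nats st ''row'' (nval l st) = nval l st * n \<Longrightarrow> bval (via x l k) st \<longleftrightarrow>
     nats st x (nval l st) \<le> nval k st \<and>
     nats st ''D'' (cell n (nval l st) (nval k st - nats st x (nval l st))) > 0"
  by (simp add: via_def nval_cell_exp[where n = n] not_less)

text \<open>The invariants also cover the rows not yet reached: these must still be zero, since an
  unattainable entry is never written.\<close>

lemma wp_table:
  assumes n: "nats st ''n'' 0 = n" and row: "\<forall>l\<le>n. nats st ''row'' l = l * n"
    and a: "nats st ''a'' = a" and b: "nats st ''b'' = b" and D: "\<forall>i. nats st ''D'' i = 0"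
  shows "wp table_prog (n * ((n + 1) * 6 + 4) + 3)
    (\<lambda>st. \<forall>l\<le>n. \<forall>k\<le>n. nats st ''D'' (cell n l k) > 0 \<longleftrightarrow> attain a b l k) st"
  unfolding table_prog_def
proof (rule wp_Seq[where t = 1 and u = "n * ((n + 1) * 6 + 4) + 2" and
      P = "\<lambda>st. \<forall>i. nats st ''D'' i = (if i = 0 then 1 else 0)"], goal_cases)
  case 1
  show ?case using D by (intro wp_loop_free) auto
next
  case (2 st0)
  have st0: "nats st0 ''n'' 0 = n" "nats st0 ''row'' = nats st ''row''" "nats st0 ''a'' = a"
    "nats st0 ''b'' = b" "\<forall>i. nats st0 ''D'' i = (if i = 0 then 1 else 0)"
    using 2 assms by (simp_all add: frame_def)
  show ?case
  proof (rule wp_For[where N = n and t = "(n + 1) * 6 + 2" and I = "\<lambda>i st. \<forall>l. \<forall>k\<le>n.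
      nats st ''D'' (cell n l k) > 0 \<longleftrightarrow> l \<le> i \<and> attain a b l k"], goal_cases)
    case 3
    then show ?case using st0(5) by (auto simp: cell_def)
  next
    case (4 i st1)
    have st1: "nats st1 ''n'' 0 = n" "nats st1 ''row'' = nats st ''row''" "nats st1 ''a'' = a"
      "nats st1 ''b'' = b"
      using 4(3) st0 by (simp_all add: frame_def)
    show ?case
    proof (rule wp_For[where N = "n + 1" and t = 4 and I = "\<lambda>j st. \<forall>l. \<forall>k\<le>n.
        nats st ''D'' (cell n l k) > 0 \<longleftrightarrow> (l \<le> i \<or> l = Suc i \<and> k < j) \<and> attain a b l k"],
        goal_cases)
      case 3
      then show ?case using 4(4) by auto
    next
      case (4 j st2)
      have st2: "nats st2 ''n'' 0 = n" "nats st2 ''row'' = nats st ''row''" "nats st2 ''a'' = a"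
        "nats st2 ''b'' = b" "nats st2 ''l'' 0 = i" "nats st2 ''k'' 0 = j"
        using 4 st1 \<open>nats st1 ''l'' 0 = i\<close> by (simp_all add: frame_def)
      have j: "j \<le> n" using 4 by simp
      have idx: "nats st ''row'' i = i * n" "nats st ''row'' (Suc i) = Suc i * n"
        using row \<open>i < n\<close> by simp_all
      have old: "nats st2 ''D'' (cell n i (j - x)) > 0 \<longleftrightarrow> attain a b i (j - x)" for x
        using 4(4) j by auto
      then have old0: "nats st2 ''D'' (cell n i (j - x)) = 0 \<longleftrightarrow> \<not> attain a b i (j - x)" for x
        by (metis gr0I less_numeral_extra(3))
      \<comment> \<open>The first conditional may write to row \<open>Suc i\<close> before the
        second reads row \<open>i\<close>; distinct indices keep that read unaffected.\<close>
      have ne: "cell n i (j - x) \<noteq> cell n (Suc i) j" for x using cell_inject j by simp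
      let ?D = "(nats st2 ''D'')(cell n (Suc i) j := 1)"
      let ?c = "Seq (Cond (via ''a'' (Var ''l'') (Var ''k''))
                (NPut ''D'' (cell_exp (NAdd (Var ''l'') (NConst 1)) (Var ''k'')) (NConst 1)) Skip)
             (Cond (via ''b'' (Var ''l'') (Var ''k''))
                (NPut ''D'' (cell_exp (NAdd (Var ''l'') (NConst 1)) (Var ''k'')) (NConst 1)) Skip)"
      have "nats (eff ?c st2) ''D'' = (if attain a b (Suc i) j then ?D else nats st2 ''D'')"
        using st2 idx
        by (auto simp: bval_via[where n = n] nval_cell_exp[where n = n] old old0 ne)
      \<comment> \<open>Leaving the cell alone records that the load is unattainable.\<close>
      moreover have "nats st2 ''D'' (cell n (Suc i) j) = 0"
        using 4(4)[rule_format, of j "Suc i"] j by simp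
      ultimately show ?case using 4(4) j
        by (intro wp_loop_free) (auto simp: cell_inject less_Suc_eq simp del: attain.simps eff.simps)
    qed (use st1 in \<open>auto simp: frame_def\<close>)
  qed (use st0 in \<open>auto simp: frame_def\<close>)
qed simp

lemma load_cost_le:
  assumes "valid_speeds 2 s" "k \<le> n"
  shows "load_cost n s k \<le> real n"
proof -
  have "s 0 \<ge> 1" "s 1 \<ge> 1" using assms(1) by (auto simp: valid_speeds_def)
  then have "real k / s 0 \<le> real k" "real (n - k) / s 1 \<le> real (n - k)"
    by (simp_all add: divide_le_eq mult_le_cancel_left1)
  then show ?thesis using assms(2) by (simp add: load_cost_def)
qed

text \<open>The sentinel \<open>n + 1\<close> exceeds every load cost because all speeds are at least 1.\<close>

lemma wp_choose:
  assumes n: "nats st ''n'' 0 = n" and row: "\<forall>l\<le>n. nats st ''row'' l = l * n"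
    and r: "\<forall>k\<le>n. reals st ''r'' k = real k"
    and s: "reals st ''s'' 0 = s 0" "reals st ''s'' 1 = s 1" "valid_speeds 2 s"
    and D: "\<forall>k\<le>n. nats st ''D'' (cell n n k) > 0 \<longleftrightarrow> R k"
    and ex: "\<exists>k\<le>n. R k"
  shows "wp choose_prog ((n + 1) * 10 + 3) (\<lambda>st. nats st ''cur'' 0 \<le> n \<and> R (nats st ''cur'' 0) \<and>
    (\<forall>k\<le>n. R k \<longrightarrow> load_cost n s (nats st ''cur'' 0) \<le> load_cost n s k)) st"
  unfolding choose_prog_def
proof (rule wp_Seq[where t = 1 and u = "(n + 1) * 10 + 2" and
      P = "\<lambda>st. reals st ''best'' 0 = real n + 1"], goal_cases)
  case 1
  show ?case using r n by (intro wp_loop_free) auto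
next
  case (2 st0)
  have st0: "nats st0 ''n'' 0 = n" "nats st0 ''row'' = nats st ''row''" "nats st0 ''D'' = nats st ''D''"
    "reals st0 ''r'' = reals st ''r''" "reals st0 ''s'' = reals st ''s''"
    "reals st0 ''best'' 0 = real n + 1"
    using 2 n by (simp_all add: frame_def choose_step_def)
  \<comment> \<open>Either \<open>best\<close> is still the sentinel, or \<open>cur\<close> is an
    attainable load whose cost is \<open>best\<close>.\<close>
  let ?I = "\<lambda>i st. (\<forall>k<i. R k \<longrightarrow> reals st ''best'' 0 \<le> load_cost n s k) \<and>
        (reals st ''best'' 0 = real n + 1 \<or>
          nats st ''cur'' 0 \<le> n \<and> R (nats st ''cur'' 0) \<and>
          reals st ''best'' 0 = load_cost n s (nats st ''cur'' 0))"
  show ?case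
  proof (rule wp_For[where N = "n + 1" and t = 8 and I = ?I], goal_cases)
    case (4 i st1)
    have i: "i \<le> n" using 4 by simp
    have st1: "nats st1 ''n'' 0 = n" "nats st1 ''row'' n = n * n" "nats st1 ''D'' = nats st ''D''"
      "reals st1 ''r'' i = real i" "reals st1 ''r'' (n - i) = real (n - i)"
      "reals st1 ''s'' 0 = s 0" "reals st1 ''s'' (Suc 0) = s 1" "nats st1 ''k'' 0 = i"
      using 4 st0 r s row i by (simp_all add: frame_def choose_step_def)
    have test: "nats st ''D'' (cell n n i) > 0 \<longleftrightarrow> R i" using D i by simp
    show ?case
    proof (rule wp_Cond[where t = 7], goal_cases)
      case 1
      then have "R i" using test by (simp add: st1 nval_cell_exp[where n = n])
      have "(if real i / s 0 < real (n - i) / s 1 then real (n - i) / s 1 else real i / s 0)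
          = load_cost n s i"
        by (simp add: load_cost_def max_def)
      then have "reals (eff choose_step st1) ''best'' 0 =
            (if load_cost n s i < reals st1 ''best'' 0 then load_cost n s i else reals st1 ''best'' 0)"
          "nats (eff choose_step st1) ''cur'' 0 =
            (if load_cost n s i < reals st1 ''best'' 0 then i else nats st1 ''cur'' 0)"
        unfolding choose_step_def by (auto simp: st1 simp del: of_nat_diff split: if_splits)
      then have "?I (Suc i) (nput ''k'' 0 (Suc i) (eff choose_step st1))"
        using 4(4) i \<open>R i\<close> by (auto simp: less_Suc_eq)
      then show ?case by (intro wp_loop_free) (auto simp: choose_step_def)
    next
      case 2
      then have "\<not> R i" using test by (simp add: st1 nval_cell_exp[where n = n])
      then show ?case using 4(4) by (intro wp_loop_free) (auto simp: less_Suc_eq)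
    qed simp
  next
    case (5 st1)
    \<comment> \<open>Some attainable load costs at most \<open>n\<close>, so the sentinel has been
      replaced by the end.\<close>
    obtain k where k: "k \<le> n" "R k" using ex by blast
    then have "reals st1 ''best'' 0 \<le> load_cost n s k" using 5 by simp
    then have "reals st1 ''best'' 0 \<noteq> real n + 1" using load_cost_le[OF s(3) k(1)] by simp
    then show ?case using 5 by (auto simp: less_Suc_eq_le)
  qed (use st0 in \<open>auto simp: frame_def choose_step_def\<close>)
qed simp

text \<open>The load \<open>K\<close> stays split into \<open>cur\<close>, attainable with the
  classes not yet visited, and the contributions already selected. Unvisited entries of
  \<open>swap\<close> are zero, so selecting \<open>a\<close> requires no write.\<close>

lemma wp_trace:
  assumes n: "nats st ''n'' 0 = n" and row: "\<forall>l\<le>n. nats st ''row'' l = l * n"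
    and a: "nats st ''a'' = a" and b: "nats st ''b'' = b" and swap: "\<forall>l. nats st ''swap'' l = 0"
    and D: "\<forall>l\<le>n. \<forall>k\<le>n. nats st ''D'' (cell n l k) > 0 \<longleftrightarrow> attain a b l k"
    and K: "nats st ''cur'' 0 = K" "K \<le> n" "attain a b n K"
  shows "wp trace_prog (6 * n + 2)
    (\<lambda>st. K = (\<Sum>l<n. if nats st ''swap'' l > 0 then b l else a l)) st"
  unfolding trace_prog_def
proof (rule wp_For[where N = n and t = 4 and I = "\<lambda>i st. attain a b (n - i) (nats st ''cur'' 0) \<and>
      (\<forall>l<n - i. nats st ''swap'' l = 0) \<and>
      K = nats st ''cur'' 0 + (\<Sum>l = n - i..<n. if nats st ''swap'' l > 0 then b l else a l)"],
    goal_cases)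
  case (4 i st1)
  define l where "l = n - 1 - i"
  have l: "n - i = Suc l" "n - Suc i = l" "l < n" using 4(1) by (auto simp: l_def)
  have st1: "nats st1 ''n'' 0 = n" "nats st1 ''i'' 0 = i" "nats st1 ''row'' l = l * n"
    "nats st1 ''a'' = a" "nats st1 ''b'' = b" "nats st1 ''D'' = nats st ''D''"
    using 4 n a b row l by (simp_all add: frame_def)
  define cur where "cur = nats st1 ''cur'' 0"
  have cur: "attain a b (Suc l) cur" "cur \<le> n" using 4(4) K l by (auto simp: cur_def)
  have test: "nats st ''D'' (cell n l (cur - x)) > 0 \<longleftrightarrow> attain a b l (cur - x)" for x
    using D cur l by simp
  then have test0: "nats st ''D'' (cell n l (cur - x)) = 0 \<longleftrightarrow> \<not> attain a b l (cur - x)" for x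
    by (metis gr0I less_numeral_extra(3))
  have split: "(\<Sum>j = l..<n. g j) = g l + (\<Sum>j = Suc l..<n. g j)" for g :: "nat \<Rightarrow> nat"
    using l by (simp add: sum.atLeast_Suc_lessThan)
  \<comment> \<open>Setting \<open>swap\<close> at \<open>l\<close> does not affect the selections
    already made at larger indices.\<close>
  have upd: "(\<Sum>j = Suc l..<n. if 0 < (if j = l then 1 else nats st1 ''swap'' j) then b j else a j) =
      (\<Sum>j = Suc l..<n. if 0 < nats st1 ''swap'' j then b j else a j)"
    by (rule sum.cong) auto
  have inv: "K = cur + (\<Sum>j = Suc l..<n. if 0 < nats st1 ''swap'' j then b j else a j)"
    "\<forall>j\<le>l. nats st1 ''swap'' j = 0"
    using 4(4) l by (auto simp: cur_def)
  show ?case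
    using cur inv
    by (intro wp_loop_free)
      (auto simp: st1 bval_via[where n = n] test test0 split upd l cur_def[symmetric]
        l_def[symmetric] l_def[symmetric, simplified])
next
  case (5 st')
  then show ?case by (simp add: lessThan_atLeast0)
qed (use assms in \<open>auto simp: frame_def\<close>)

lemma wp_output:
  assumes "nats st ''n'' 0 = n"
    and lab: "nats st ''lab'' = lab" and col: "nats st ''col'' = col" and sw: "nats st ''swap'' = swap"
  shows "wp output_prog (4 * n + 2)
    (\<lambda>st. \<forall>v<n. nats st ''out'' v = (if swap (lab v) > 0 then 1 - col v else col v)) st"
  unfolding output_prog_def
proof (rule wp_For[where N = n and t = 2 and I = "\<lambda>k st.
    \<forall>v<k. nats st ''out'' v = (if swap (lab v) > 0 then 1 - col v else col v)"], goal_cases)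
  case (4 k st')
  have "nats st' ''lab'' = lab" "nats st' ''col'' = col" "nats st' ''swap'' = swap"
    using 4 assms by (simp_all add: frame_def)
  then show ?case using 4 by (intro wp_loop_free) (auto simp: less_Suc_eq)
qed (use assms in \<open>auto simp: frame_def\<close>)

section \<open>Composition of the phases and the cubic bound\<close>

lemmas prog_defs = init_prog_def link_prog_def merge_prog_def count_prog_def table_prog_def
  choose_step_def choose_prog_def trace_prog_def output_prog_def

text \<open>The postconditions of the phases are chained, with frames carrying the earlier results
  along. Only linking contributes a cubic term; the factor 100 generously absorbs the sum of all
  budgets.\<close>

lemma wp_solver:
  assumes E: "bipartite {..<n} E" and s: "valid_speeds 2 s"
  shows "wp solver (100 * (n + 1) ^ 3)
    (\<lambda>st. optimal_schedule 2 n E (\<lambda>_. 1) s (output_schedule st)) (input_state 2 n E s)"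
    (is "wp _ _ ?Q ?st")
proof -
  \<comment> \<open>The index must lie below \<open>n * n\<close>, the range in which
    \<open>input_state\<close> decodes it by \<open>div\<close> and \<open>mod\<close>.\<close>
  have G: "nats ?st ''G'' (u * n + v) > 0 \<longleftrightarrow> {u, v} \<in> E" if "u < n" "v < n" for u v
  proof -
    have "u * n + v < Suc u * n" using that by simp
    also have "\<dots> \<le> n * n" using that by (intro mult_le_mono1) simp
    finally have "u * n + v < n * n" .
    then show ?thesis using that by (simp add: input_state_def)
  qed
  obtain \<tau>0 where \<tau>0: "feasible 2 n E \<tau>0" using bipartite_feasible[OF E] by blast
  have zero: "nats ?st x k = 0" if "x \<notin> {''n'', ''G''}" for x k
    using that by (simp add: input_state_def)
  have load: "card {v. v < n \<and> \<sigma> v = 0} \<le> n" for \<sigma> :: "nat \<Rightarrow> nat"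
    using card_mono[of "{..<n}" "{v. v < n \<and> \<sigma> v = 0}"] by auto
  let ?t = "n * (n * (6 * n + 9) + 4) + 2"
  let ?u = "n * ((n + 1) * 6 + 4) + 3"
  show ?thesis
    unfolding solver_def
  proof (rule wp_Seq[where u = "?t + (4 * n + 2 + (?u + ((n + 1) * 10 + 3 + (6 * n + 2 + (4 * n + 2)))))"],
      rule wp_init[where n = n], goal_cases)
    case (4 st1)
    have n1: "nats st1 ''n'' 0 = n"
      using 4(2) by (simp add: frame_def prog_defs input_state_def)
    have G1: "nats st1 ''G'' = nats ?st ''G''"
      using 4(2) by (simp add: frame_def prog_defs)
    have s1: "reals st1 ''s'' 0 = s 0" "reals st1 ''s'' 1 = s 1"
      using 4(2) by (simp_all add: frame_def prog_defs input_state_def)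
    \<comment> \<open>Later phases rely on zero-initialised arrays; \<open>z1\<close>,
      \<open>z2\<close> and \<open>z3\<close> track those not yet written.\<close>
    have z1: "nats st1 x k = 0" if "x \<in> {''col'', ''a'', ''b'', ''D'', ''swap''}" for x k
      using frame_nats[OF 4(2), of x] zero[of x k] that by (auto simp: prog_defs)
    show ?case
    proof (rule wp_Seq[OF wp_link[where n = n and E = E] _ order_refl], goal_cases)
      case (7 st2)
      define lab col where "lab = nats st2 ''lab''" and "col = nats st2 ''col''"
      define a b where "a = class_size n lab col 0" and "b = class_size n lab col 1"
      have fc: "forced_colouring n E ({..<n} \<times> {..<n}) lab col"
        using 7 by (simp add: lab_def col_def)
      then have rng: "\<forall>v<n. lab v < n \<and> col v < 2" by (simp add: forced_colouring_def)
      have st2: "nats st2 ''n'' 0 = n" "nats st2 ''row'' = nats st1 ''row''"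
        "reals st2 ''r'' = reals st1 ''r''" "reals st2 ''s'' = reals st1 ''s''"
        using 7 n1 by (simp_all add: frame_def prog_defs)
      have z2: "nats st2 x k = 0" if "x \<in> {''a'', ''b'', ''D'', ''swap''}" for x k
        using frame_nats[OF 7(2), of x] z1[of x k] that by (auto simp: prog_defs)
      show ?case
      proof (rule wp_Seq[OF wp_count[where n = n and lab = lab and col = col] _ order_refl], goal_cases)
        case (6 st3)
        have st3: "nats st3 ''n'' 0 = n" "nats st3 ''row'' = nats st1 ''row''"
          "reals st3 ''r'' = reals st1 ''r''" "reals st3 ''s'' = reals st1 ''s''"
          "nats st3 ''lab'' = lab" "nats st3 ''col'' = col" "nats st3 ''a'' = a" "nats st3 ''b'' = b"
          using 6 st2 by (simp_all add: frame_def prog_defs lab_def col_def a_def b_def)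
        have z3: "nats st3 x k = 0" if "x \<in> {''D'', ''swap''}" for x k
          using frame_nats[OF 6(2), of x] z2[of x k] that by (auto simp: prog_defs)
        show ?case
        proof (rule wp_Seq[OF wp_table[where n = n and a = a and b = b] _ order_refl], goal_cases)
          case (6 st4)
          have st4: "nats st4 ''n'' 0 = n" "nats st4 ''row'' = nats st1 ''row''"
            "reals st4 ''r'' = reals st1 ''r''" "reals st4 ''s'' = reals st1 ''s''"
            "nats st4 ''lab'' = lab" "nats st4 ''col'' = col" "nats st4 ''a'' = a"
            "nats st4 ''b'' = b" "\<forall>l. nats st4 ''swap'' l = 0"
            using 6(2) st3 z3 by (simp_all add: frame_def prog_defs)
          show ?case
          proof (rule wp_Seq[OF wp_choose[where n = n and s = s and R = "attain a b n"] _ order_refl], goal_cases)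
            case (9 st5)
            define K where "K = nats st5 ''cur'' 0"
            have K: "K \<le> n" "attain a b n K"
              "\<And>k. k \<le> n \<Longrightarrow> attain a b n k \<Longrightarrow> load_cost n s K \<le> load_cost n s k"
              using 9(1) by (auto simp: K_def)
            have st5: "nats st5 ''n'' 0 = n" "nats st5 ''row'' = nats st1 ''row''"
              "nats st5 ''D'' = nats st4 ''D''"
              "nats st5 ''lab'' = lab" "nats st5 ''col'' = col" "nats st5 ''a'' = a"
              "nats st5 ''b'' = b" "\<forall>l. nats st5 ''swap'' l = 0"
              using 9(2) st4 by (simp_all add: frame_def prog_defs)
            show ?case
            proof (rule wp_Seq[OF wp_trace[where n = n and a = a and b = b and K = K] _ order_refl], goal_cases)
              case (10 st6)
              define swap where "swap = nats st6 ''swap''"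
              have st6: "nats st6 ''n'' 0 = n" "nats st6 ''lab'' = lab" "nats st6 ''col'' = col"
                using 10(2) st5 by (simp_all add: frame_def prog_defs)
              have "?Q st7" if out: "\<forall>v<n. nats st7 ''out'' v =
                (if swap (lab v) > 0 then 1 - col v else col v)" for st7
              proof -
                let ?\<sigma> = "output_schedule st7"
                have \<sigma>: "\<And>v. v < n \<Longrightarrow> ?\<sigma> v = (if swap (lab v) > 0 then 1 - col v else col v)"
                  using out by (simp add: output_schedule_def)
                have feas: "feasible 2 n E ?\<sigma>" by (rule feasible_flip[OF fc \<sigma>])
                \<comment> \<open>The selection in \<open>swap\<close> that sums to \<open>K\<close>
                  is the one that the output schedule applies.\<close>
                have "card {v. v < n \<and> ?\<sigma> v = 0} = K"
                  using card_machine_0[OF rng \<sigma>] 10(1) unfolding swap_def a_def b_def by simp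
                \<comment> \<open>The load of any feasible schedule is attainable, so it competed in
                  the choice of \<open>K\<close>.\<close>
                moreover have "load_cost n s K \<le> makespan 2 n (\<lambda>_. 1) s \<tau>"
                  if \<tau>: "feasible 2 n E \<tau>" for \<tau>
                  using K(3)[OF load] feasible_attain[OF fc \<tau>] \<tau>
                  by (simp add: makespan_2 feasible_2_iff a_def b_def)
                ultimately show ?thesis
                  using feas by (simp add: optimal_schedule_def makespan_2 feasible_2_iff)
              qed
              then show ?case
                by (intro wp_mono[OF wp_output[OF st6 refl]]) (simp add: swap_def)
            qed (use 4(1) 6(1) st5 K in \<open>simp_all add: K_def\<close>)
          next
            case 8
            show ?case using feasible_attain[OF fc \<tau>0] load by (auto simp: a_def b_def)
          qed (use 4(1) 6(1) st4 s1 s in simp_all)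
        qed (use 4(1) st3 z3 in simp_all)
      qed (use rng st2 z2 in \<open>simp_all add: lab_def col_def\<close>)
    qed (use 4(1) n1 G G1 z1 \<tau>0 in auto)
  qed (auto simp: input_state_def algebra_simps power3_eq_cube)
qed

theorem theorem4:
  "\<exists>(c :: com) (T :: nat \<Rightarrow> nat).
     (\<lambda>n. real (T n)) \<in> O(\<lambda>n. real n ^ 3) \<and> solves_Q_bipartite_unit 2 c T"
proof (intro exI conjI)
  show "(\<lambda>n. real (100 * (n + 1) ^ 3)) \<in> O(\<lambda>n. real n ^ 3)"
  \<comment> \<open>For \<open>n \<ge> 1\<close>, \<open>n + 1 \<le> 2 * n\<close>, and
    \<open>800\<close> is 100 times the cube of 2.\<close>
  proof (rule bigoI[of _ 800])
    show "\<forall>\<^sub>F n in at_top. norm (real (100 * (n + 1) ^ 3)) \<le> 800 * norm (real n ^ 3)"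
    proof (rule eventually_mono[OF eventually_ge_at_top[of 1]])
      fix n :: nat assume "1 \<le> n"
      then have "(real n + 1) ^ 3 \<le> (2 * real n) ^ 3" by (intro power_mono) auto
      then show "norm (real (100 * (n + 1) ^ 3)) \<le> 800 * norm (real n ^ 3)"
        by (simp add: power_mult_distrib add.commute)
    qed
  qed
  show "solves_Q_bipartite_unit 2 solver (\<lambda>n. 100 * (n + 1) ^ 3)"
    using wp_solver by (fastforce simp: solves_Q_bipartite_unit_def wp_def)
qed

end
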